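(* Let $K\ge1$ be an integer with $K\equiv 2\pmod 4$, and let $p_1^{a_1}p_2^{a_2}\cdots p_r^{a_r}$ be the prime factorization of $K^2+4$ with $p_1=2$. If $m>1$ is an integer with $\pi_K(m)=m$, then either $m=2^{j_1+1}$ or $m=2^{j_1+2}p_2^{j_2}\cdots p_r^{j_r}$ for some integers $j_1,\dots,j_r\ge 0$.
   Context: The $K$-Fibonacci sequence is $F_{K,0}=0$, $F_{K,1}=1$, $F_{K,n}=K F_{K,n-1}+F_{K,n-2}$; for an integer $m>1$, $\pi_K(m)$ is the length of its shortest period modulo $m$. *)

theory Defs
  imports "HOL-Number_Theory.Number_Theory"
begin

fun kfib :: "nat \<Rightarrow> nat \<Rightarrow> nat" where
  "kfib K 0 = 0"
| "kfib K (Suc 0) = 1"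
| "kfib K (Suc (Suc n)) = K * kfib K (Suc n) + kfib K n"

(* The reduced sequence is purely periodic for every modulus m > 0, because the recurrence
   can be run backwards; so the set of positive periods below is non-empty and LEAST is
   meaningful. *)
definition kfib_period :: "nat \<Rightarrow> nat \<Rightarrow> nat" where
  "kfib_period K m = (LEAST t. 0 < t \<and> (\<forall>n. [kfib K (n + t) = kfib K n] (mod m)))"

end

theory Submission
  imports Defs
begin

text \<open>
  Write D = K^2 + 4. For an odd prime q not dividing D, the congruence for the q-th Lucas number
  together with Cassini's identity gives F(q) = 1 or F(q) = -1 modulo q, whence 2(q - 1)(q + 1) is
  a period modulo q; for an odd prime q dividing D, 4q is a period modulo q, and every period is
  divisible by 4; modulo 2 the number 2 is a period. Passing from q^e to q^(e+1) multiplies a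
  period by q at most. So m, being its own shortest period, divides the product of the numbers
  q^(e-1) c(q) over the prime powers q^e exactly dividing m, where c(q) is the above period. If q
  is the largest odd prime factor of m not dividing D, then q divides none of the c's, and that
  product has one factor q too few. Hence every odd prime factor of m divides D, and if there is
  one at all then 4 divides m.
\<close>

section \<open>Addition formula, Cassini's identity and the arithmetic of periods\<close>

definition kfib_is_period :: "nat \<Rightarrow> nat \<Rightarrow> nat \<Rightarrow> bool" where
  "kfib_is_period K m t \<longleftrightarrow> (\<forall>n. [kfib K (n + t) = kfib K n] (mod m))"

lemma kfib_add:
  "kfib K (Suc (m + n)) = kfib K (Suc m) * kfib K (Suc n) + kfib K m * kfib K n"
proof (induction n rule: induct_nat_012)
  case (ge2 n)
  have "kfib K (Suc (m + Suc (Suc n))) = K * kfib K (Suc (m + Suc n)) + kfib K (Suc (m + n))"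
    by simp
  also have "\<dots> = kfib K (Suc m) * kfib K (Suc (Suc (Suc n))) + kfib K m * kfib K (Suc (Suc n))"
    unfolding ge2 kfib.simps(3)[of K n] kfib.simps(3)[of K "Suc n"] by (simp only: algebra_simps)
  finally show ?case .
qed auto

text \<open>A variant of the addition formula free of index subtraction.\<close>

lemma kfib_add_int:
  "int (kfib K (m + n)) =
     int (kfib K m) * int (kfib K (Suc n)) + int (kfib K (Suc m)) * int (kfib K n)
       - int K * int (kfib K m) * int (kfib K n)"
proof (cases m)
  case (Suc l)
  then show ?thesis using kfib_add[of K l n] by (simp add: algebra_simps)
qed simp

text \<open>The companion matrix has determinant -1, and the left-hand side is the determinant of
  its power with exponent n + 1.\<close>

lemma kfib_cassini:
  "int (kfib K (Suc (Suc n))) * int (kfib K n) - int (kfib K (Suc n)) ^ 2 = - ((-1) ^ n)"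
proof (induction n)
  case (Suc n)
  then show ?case by (simp add: algebra_simps power2_eq_square)
qed simp

text \<open>Two consecutive values determine the sequence: the addition formula writes the shifted
  term as a combination of the values at t and t + 1.\<close>

lemma kfib_is_periodI:
  assumes "[int (kfib K t) = 0] (mod int m)" "[int (kfib K (Suc t)) = 1] (mod int m)"
  shows "kfib_is_period K m t"
  unfolding kfib_is_period_def
proof
  fix n
  have "[int (kfib K (n + t)) = int (kfib K n) * 1 + int (kfib K (Suc n)) * 0
       - int K * int (kfib K n) * 0] (mod int m)"
    unfolding kfib_add_int by (intro cong_add cong_diff cong_mult cong_refl assms)
  then show "[kfib K (n + t) = kfib K n] (mod m)"
    by (simp add: cong_int_iff)
qed

lemma kfib_is_periodD:
  assumes "kfib_is_period K m t"
  shows "[int (kfib K t) = 0] (mod int m)" "[int (kfib K (Suc t)) = 1] (mod int m)"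
proof -
  show "[int (kfib K t) = 0] (mod int m)"
    using assms[unfolded kfib_is_period_def, rule_format, of 0] by (simp flip: cong_int_iff)
  show "[int (kfib K (Suc t)) = 1] (mod int m)"
    using assms[unfolded kfib_is_period_def, rule_format, of 1] by (simp flip: cong_int_iff)
qed

lemma kfib_is_period_add:
  "kfib_is_period K m s \<Longrightarrow> kfib_is_period K m t \<Longrightarrow> kfib_is_period K m (s + t)"
  unfolding kfib_is_period_def by (metis add.assoc cong_trans)

lemma kfib_is_period_mult:
  assumes "kfib_is_period K m t"
  shows "kfib_is_period K m (k * t)"
  by (induction k) (use assms in \<open>simp_all add: kfib_is_period_add\<close>,
    simp add: kfib_is_period_def)

lemma kfib_is_period_dvd:
  "kfib_is_period K m t \<Longrightarrow> t dvd s \<Longrightarrow> kfib_is_period K m s"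
  by (metis dvd_def kfib_is_period_mult mult.commute)

lemma kfib_is_period_modulus_dvd:
  "kfib_is_period K m t \<Longrightarrow> d dvd m \<Longrightarrow> kfib_is_period K d t"
  unfolding kfib_is_period_def using cong_dvd_modulus_nat by blast

lemma kfib_period_is_period:
  assumes "kfib_is_period K m t" "0 < t"
  shows "kfib_is_period K m (kfib_period K m)" "0 < kfib_period K m"
  using LeastI[of "\<lambda>t. 0 < t \<and> (\<forall>n. [kfib K (n + t) = kfib K n] (mod m))" t] assms
  unfolding kfib_is_period_def kfib_period_def by auto

text \<open>Division with remainder: the remainder is again a period and lies below the least
  positive one, so it is 0.\<close>

lemma kfib_period_dvd:
  assumes "kfib_is_period K m t" "0 < t"
  shows "kfib_period K m dvd t"
proof -
  let ?d = "kfib_period K m"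
  note d = kfib_period_is_period[OF assms]
  have q: "kfib_is_period K m (t div ?d * ?d)"
    by (rule kfib_is_period_mult[OF d(1)])
  have r: "kfib_is_period K m (t mod ?d)"
    unfolding kfib_is_period_def
  proof
    fix n
    have "[kfib K (n + t mod ?d + t div ?d * ?d) = kfib K (n + t mod ?d)] (mod m)"
      using q unfolding kfib_is_period_def by blast
    moreover have "n + t mod ?d + t div ?d * ?d = n + t"
      by (simp only: add.assoc mod_div_mult_eq)
    moreover have "[kfib K (n + t) = kfib K n] (mod m)"
      using assms unfolding kfib_is_period_def by blast
    ultimately show "[kfib K (n + t mod ?d) = kfib K n] (mod m)"
      by (metis cong_sym cong_trans)
  qed
  have "t mod ?d = 0"
  proof (rule ccontr)
    assume "t mod ?d \<noteq> 0"
    with r have "?d \<le> t mod ?d"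
      unfolding kfib_period_def kfib_is_period_def by (intro Least_le) simp
    with mod_less_divisor[OF d(2), of t] show False by simp
  qed
  then show ?thesis by auto
qed

section \<open>Lifting periods to prime powers\<close>

text \<open>In matrix form: if the t-th power of the companion matrix is 1 + Q N, then its (k t)-th
  power is 1 + k Q N modulo Q^2.\<close>

lemma kfib_multiple_cong:
  fixes Q x y :: int
  assumes "int (kfib K t) = Q * x" "int (kfib K (Suc t)) = 1 + Q * y"
  shows "[int (kfib K (k * t)) = of_nat k * Q * x] (mod Q^2) \<and>
    [int (kfib K (Suc (k * t))) = 1 + of_nat k * Q * y] (mod Q^2)"
proof (induction k)
  case (Suc k)
  have "int (kfib K (Suc k * t)) = int (kfib K (k * t)) * (1 + Q * y)
      + int (kfib K (Suc (k * t))) * (Q * x) - int K * int (kfib K (k * t)) * (Q * x)"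
    using kfib_add_int[of K "k * t" t] assms by (simp add: add.commute)
  also have "[\<dots> = (of_nat k * Q * x) * (1 + Q * y) + (1 + of_nat k * Q * y) * (Q * x)
      - int K * (of_nat k * Q * x) * (Q * x)] (mod Q^2)"
    by (intro cong_add cong_diff cong_mult cong_refl) (use Suc in auto)
  also have "(of_nat k * Q * x) * (1 + Q * y) + (1 + of_nat k * Q * y) * (Q * x)
      - int K * (of_nat k * Q * x) * (Q * x)
      = of_nat (Suc k) * Q * x + Q^2 * (2 * of_nat k * x * y - int K * of_nat k * x * x)"
    by (simp add: algebra_simps power2_eq_square)
  also have "[\<dots> = of_nat (Suc k) * Q * x] (mod Q^2)"
    by (simp add: cong_iff_dvd_diff)
  finally have 1: "[int (kfib K (Suc k * t)) = of_nat (Suc k) * Q * x] (mod Q^2)" .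
  have "int (kfib K (Suc (Suc k * t))) = int (kfib K (Suc (k * t))) * (1 + Q * y)
      + int (kfib K (k * t)) * (Q * x)"
    using kfib_add[of K "k * t" t] assms by (simp add: add.commute)
  also have "[\<dots> = (1 + of_nat k * Q * y) * (1 + Q * y) + (of_nat k * Q * x) * (Q * x)] (mod Q^2)"
    by (intro cong_add cong_mult cong_refl) (use Suc in auto)
  also have "(1 + of_nat k * Q * y) * (1 + Q * y) + (of_nat k * Q * x) * (Q * x)
      = 1 + of_nat (Suc k) * Q * y + Q^2 * (of_nat k * y * y + of_nat k * x * x)"
    by (simp add: algebra_simps power2_eq_square)
  also have "[\<dots> = 1 + of_nat (Suc k) * Q * y] (mod Q^2)"
    by (simp add: cong_iff_dvd_diff)
  finally show ?case using 1 by blast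
qed simp

text \<open>Since q divides Q, the modulus q Q divides Q^2, so the linearised formula applies; for k
  = q its correction terms are multiples of q Q.\<close>

lemma kfib_is_period_lift:
  assumes "kfib_is_period K Q t" "q dvd Q"
  shows "kfib_is_period K (q * Q) (q * t)"
proof -
  obtain x where x: "int (kfib K t) = int Q * x"
    using kfib_is_periodD(1)[OF assms(1)] unfolding cong_0_iff by blast
  obtain y where "int (kfib K (Suc t)) - 1 = int Q * y"
    using kfib_is_periodD(2)[OF assms(1)] unfolding cong_iff_dvd_diff by blast
  then have y: "int (kfib K (Suc t)) = 1 + int Q * y" by linarith
  have d: "int (q * Q) dvd int Q ^ 2"
    using assms(2) by (simp add: power2_eq_square mult_dvd_mono)
  note c = kfib_multiple_cong[OF x y, of q]
  have "[int (kfib K (q * t)) = int q * int Q * x] (mod int (q * Q))"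
    by (rule cong_dvd_modulus[OF _ d]) (use c in simp)
  moreover have "[int q * int Q * x = 0] (mod int (q * Q))"
    by (simp add: cong_iff_dvd_diff)
  moreover have "[int (kfib K (Suc (q * t))) = 1 + int q * int Q * y] (mod int (q * Q))"
    by (rule cong_dvd_modulus[OF _ d]) (use c in simp)
  moreover have "[1 + int q * int Q * y = 1] (mod int (q * Q))"
    by (simp add: cong_iff_dvd_diff)
  ultimately show ?thesis
    by (intro kfib_is_periodI) (blast intro: cong_trans)+
qed

lemma kfib_is_period_prime_power:
  assumes "kfib_is_period K q t"
  shows "kfib_is_period K (q ^ Suc e) (q ^ e * t)"
proof (induction e)
  case (Suc e)
  then show ?case
    using kfib_is_period_lift[OF Suc, of q] by (simp add: mult.assoc)
qed (use assms in simp)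

section \<open>Lucas numbers and their congruence at an odd prime\<close>

text \<open>The combination 2 F(n+1) - K F(n) is the Lucas number L(n), the sum of the n-th powers
  of the characteristic roots (K + s)/2 and (K - s)/2; the factor 2^n clears denominators.\<close>

lemma kfib_lucas_binet:
  fixes s :: real
  assumes s: "s ^ 2 = real K ^ 2 + 4"
  shows "2 ^ n * (2 * real (kfib K (Suc n)) - real K * real (kfib K n))
    = (real K + s) ^ n + (real K - s) ^ n"
proof (induction n rule: induct_nat_012)
  case (ge2 n)
  \<comment> \<open>Both K + s and K - s, the doubled characteristic roots, satisfy x^2 = 2 K x +
    4.\<close>
  have step: "x ^ Suc (Suc n) = 2 * real K * x ^ Suc n + 4 * x ^ n"
    if "x ^ 2 = 2 * real K * x + 4" for x
  proof -
    have "x ^ n * x ^ 2 = x ^ n * (2 * real K * x + 4)" using that by simp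
    then show ?thesis by (simp add: power2_eq_square algebra_simps)
  qed
  have "(real K + s) ^ 2 = 2 * real K * (real K + s) + 4"
    "(real K - s) ^ 2 = 2 * real K * (real K - s) + 4"
    using s by (simp_all add: power2_eq_square algebra_simps)
  note this[THEN step]
  then have "(real K + s) ^ Suc (Suc n) + (real K - s) ^ Suc (Suc n)
    = 2 * real K * ((real K + s) ^ Suc n + (real K - s) ^ Suc n)
      + 4 * ((real K + s) ^ n + (real K - s) ^ n)"
    by (simp only: algebra_simps)
  then show ?case unfolding ge2[symmetric] by (simp add: algebra_simps)
qed simp_all

text \<open>Expanding both powers in Binet's formula cancels the odd powers of s and turns the even
  ones into powers of D, so the identity descends from the reals to the integers.\<close>

lemma kfib_lucas_binomial:
  "2 ^ n * (2 * int (kfib K (Suc n)) - int K * int (kfib K n))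
    = (\<Sum>i\<le>n. int (n choose i) * (if even i then 2 * (int K ^ 2 + 4) ^ (i div 2) else 0)
        * int K ^ (n - i))"
proof -
  define s where "s = sqrt (real K ^ 2 + 4)"
  have s: "s ^ 2 = real K ^ 2 + 4" by (simp add: s_def)
  have "s ^ i + (- s) ^ i = (if even i then 2 * (real K ^ 2 + 4) ^ (i div 2) else 0)" for i
    by (auto simp: s[symmetric] simp flip: power_mult)
  then have "(\<Sum>i\<le>n. real (n choose i) * (if even i then 2 * (real K ^ 2 + 4) ^ (i div 2) else 0)
        * real K ^ (n - i)) = (s + real K) ^ n + (- s + real K) ^ n"
    unfolding binomial_ring sum.distrib[symmetric]
    by (intro sum.cong) (simp_all add: mult.assoc flip: distrib_right distrib_left)
  also have "\<dots> = 2 ^ n * (2 * real (kfib K (Suc n)) - real K * real (kfib K n))"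
    using kfib_lucas_binet[OF s, of n] by (simp add: add.commute)
  finally have "real_of_int (\<Sum>i\<le>n. int (n choose i)
        * (if even i then 2 * (int K ^ 2 + 4) ^ (i div 2) else 0) * int K ^ (n - i))
      = real_of_int (2 ^ n * (2 * int (kfib K (Suc n)) - int K * int (kfib K n)))"
    by (simp add: if_distrib[of real_of_int] cong: if_cong)
  then show ?thesis unfolding of_int_eq_iff by simp
qed

text \<open>This form of Fermat's theorem also covers bases divisible by q, as K may be.\<close>

lemma fermat_power_prime:
  fixes x :: nat
  assumes "prime q"
  shows "[x ^ q = x] (mod q)"
proof (cases "q dvd x")
  case True
  then have "q dvd x ^ q" using prime_gt_0_nat[OF assms] by (simp add: dvd_power_iff dvd_trans)
  with True show ?thesis by (simp add: cong_def mod_eq_0_iff_dvd)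
next
  case False
  then have "[x ^ (q - 1) * x = 1 * x] (mod q)"
    by (intro cong_mult cong_refl fermat_theorem assms)
  then show ?thesis
    using prime_gt_0_nat[OF assms] by (simp only: power_minus_mult mult_1)
qed

text \<open>In the binomial sum for n = q the inner coefficients are divisible by q and the last
  term vanishes because q is odd. Only 2 K^q remains, and Fermat's theorem gives L(q) = K modulo
  q.\<close>

lemma kfib_lucas_prime_cong:
  assumes "prime q" "odd q"
  shows "[2 * int (kfib K (Suc q)) - int K * int (kfib K q) = int K] (mod int q)"
proof -
  let ?L = "2 * int (kfib K (Suc q)) - int K * int (kfib K q)"
  let ?f = "\<lambda>i. int (q choose i) * (if even i then 2 * (int K ^ 2 + 4) ^ (i div 2) else 0)
        * int K ^ (q - i)"
  have "int q dvd ?f i" if "i \<in> {..q} - {0}" for i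
  proof (cases "i = q")
    case False
    with that have "q dvd (q choose i)"
      by (intro dvd_choose_prime) (use assms in auto)
    then have "int q dvd int (q choose i)" by simp
    then show ?thesis by (simp add: dvd_mult2)
  qed (use assms in simp)
  then have "int q dvd sum ?f ({..q} - {0})" by (rule dvd_sum)
  moreover have "sum ?f {..q} = ?f 0 + sum ?f ({..q} - {0})"
    by (rule sum.remove) auto
  ultimately have L: "[2 ^ q * ?L = 2 * int K ^ q] (mod int q)"
    unfolding kfib_lucas_binomial by (simp add: cong_iff_dvd_diff)
  have fermat: "[int x ^ q = int x] (mod int q)" for x
    using fermat_power_prime[OF assms(1), of x] by (simp flip: cong_int_iff)
  have "[2 ^ q * ?L = 2 * ?L] (mod int q)"
    using fermat[of 2] by (intro cong_mult cong_refl) simp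
  moreover have "[2 * int K ^ q = 2 * int K] (mod int q)"
    by (intro cong_mult cong_refl fermat)
  ultimately have "[2 * ?L = 2 * int K] (mod int q)"
    using L by (metis (no_types, lifting) cong_sym cong_trans)
  moreover have "coprime 2 (int q)" using assms by simp
  ultimately show ?thesis
    using cong_mult_lcancel by blast
qed

section \<open>Odd primes not dividing the discriminant\<close>

text \<open>Either q - 1 or 2(q + 1) is a period, according to the sign of F(q) modulo q; the stated
  number is a common multiple of both, so the sign need not be known.\<close>

lemma kfib_is_period_regular_prime:
  assumes "prime q" "odd q" "\<not> q dvd K ^ 2 + 4"
  shows "kfib_is_period K q (2 * (q - 1) * (q + 1))"
proof -
  obtain n where n: "q = Suc n" using prime_gt_0_nat[OF assms(1)] gr0_implies_Suc by blast
  define a where "a = int (kfib K n)"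
  define b where "b = int (kfib K q)"
  have S: "int (kfib K (Suc q)) = int K * b + a" by (simp add: n a_def b_def)
  have pq: "prime (int q)" using assms by simp
  have "\<not> int q dvd 2"
    using assms(1,2)
    by (metis dvd_refl int_dvd_int_iff of_nat_numeral primes_dvd_imp_eq two_is_prime_nat)
  then have cancel2: "int q dvd x" if "int q dvd 2 * x" for x
    using that pq prime_dvd_mult_iff by blast
  have tr: "int q dvd 2 * a + int K * b - int K"
    using kfib_lucas_prime_cong[OF assms(1,2), of K] unfolding S b_def[symmetric]
    by (simp add: cong_iff_dvd_diff algebra_simps)
  have "even n" using assms(2) n by simp
  then have cas: "(int K * b + a) * a - b ^ 2 = -1"
    using kfib_cassini[of K n] S n by (simp add: a_def b_def)
  \<comment> \<open>With L = 2a + K b = L(q), Cassini's identity reads L^2 - D b^2 = -4, so the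
    left-hand side equals L^2 - K^2, which the congruence L = K makes divisible by q.\<close>
  have "(int K ^ 2 + 4) * (b ^ 2 - 1)
    = (2 * a + int K * b - int K) * (2 * a + int K * b + int K)
      - 4 * ((int K * b + a) * a - b ^ 2 + 1)"
    by (simp add: algebra_simps power2_eq_square)
  also have "\<dots> = (2 * a + int K * b - int K) * (2 * a + int K * b + int K)"
    using cas by simp
  finally have "int q dvd (int K ^ 2 + 4) * (b ^ 2 - 1)"
    using tr by simp
  moreover have "\<not> int q dvd int K ^ 2 + 4"
    using assms(3) by (metis int_dvd_int_iff of_nat_add of_nat_numeral of_nat_power)
  ultimately have "int q dvd (b - 1) * (b + 1)"
    using pq by (simp add: prime_dvd_mult_iff power2_eq_square square_diff_one_factored mult.commute)
  then consider "int q dvd b - 1" | "int q dvd b + 1"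
    using pq prime_dvd_mult_iff by blast
  then show ?thesis
  proof cases
    case 1
    \<comment> \<open>As b = 1 modulo q, the trace congruence forces F(q-1) = 0, and q - 1 is a
      period.\<close>
    have "2 * a = (2 * a + int K * b - int K) - int K * (b - 1)" by (simp add: algebra_simps)
    then have "int q dvd a" using 1 tr by (metis cancel2 dvd_diff dvd_mult)
    then have "kfib_is_period K q n"
      by (intro kfib_is_periodI)
        (use 1 n in \<open>simp_all add: a_def b_def cong_iff_dvd_diff\<close>)
    then show ?thesis by (rule kfib_is_period_dvd) (simp add: n)
  next
    case 2
    \<comment> \<open>As b = -1 modulo q, it follows that F(q+1) = 0 and F(q+2) = -1: shifting by q
      + 1 negates the sequence, and shifting twice restores it.\<close>
    have "2 * (int K * b + a) = (2 * a + int K * b - int K) + int K * (b + 1)"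
      by (simp add: algebra_simps)
    then have z: "int q dvd int K * b + a" using 2 tr by (metis cancel2 dvd_add dvd_mult)
    have d1: "int q dvd int (kfib K (Suc q))" using S z by simp
    have e: "int (kfib K (Suc (Suc q))) = int K * (int K * b + a) + b"
      using S by (simp add: b_def)
    have "int (kfib K (Suc (Suc q))) + 1 = int K * (int K * b + a) + (b + 1)"
      using e by simp
    then have d2: "int q dvd int (kfib K (Suc (Suc q))) + 1"
      using z 2 by (metis dvd_add dvd_mult)
    have "kfib_is_period K q (Suc q + Suc q)"
    proof (rule kfib_is_periodI)
      show "[int (kfib K (Suc q + Suc q)) = 0] (mod int q)"
        unfolding kfib_add_int cong_0_iff
        using d1 by (simp only: dvd_add dvd_diff dvd_mult dvd_mult2)
      have "int (kfib K (Suc (Suc q + Suc q))) - 1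
        = (int (kfib K (Suc (Suc q))) + 1) * (int (kfib K (Suc (Suc q))) - 1)
          + int (kfib K (Suc q)) * int (kfib K (Suc q))"
        unfolding kfib_add by (simp add: algebra_simps del: kfib.simps)
      then show "[int (kfib K (Suc (Suc q + Suc q))) = 1] (mod int q)"
        unfolding cong_iff_dvd_diff using d1 d2 by (metis dvd_add dvd_mult2)
    qed
    moreover have "2 * (q - 1) * (q + 1) = (Suc q + Suc q) * (q - 1)"
      by (simp only: mult_2 mult.assoc mult.commute[of "q - 1"] Suc_eq_plus1 distrib_right)
    ultimately show ?thesis by (metis dvd_triv_left kfib_is_period_dvd)
  qed
qed

section \<open>Odd primes dividing the discriminant\<close>

text \<open>Modulo D the characteristic polynomial has the double root K/2.\<close>

lemma kfib_cong_discriminant: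
  "[2 ^ n * int (kfib K (Suc n)) = (int n + 1) * int K ^ n] (mod (int K ^ 2 + 4))"
proof (induction n rule: induct_nat_012)
  case (ge2 n)
  have "2 ^ Suc (Suc n) * int (kfib K (Suc (Suc (Suc n))))
    = 2 * int K * (2 ^ Suc n * int (kfib K (Suc (Suc n)))) + 4 * (2 ^ n * int (kfib K (Suc n)))"
    by (simp add: algebra_simps)
  also have "[\<dots> = 2 * int K * ((int (Suc n) + 1) * int K ^ Suc n)
      + 4 * ((int n + 1) * int K ^ n)] (mod (int K ^ 2 + 4))"
    by (intro cong_add cong_mult cong_refl ge2)
  also have "2 * int K * ((int (Suc n) + 1) * int K ^ Suc n) + 4 * ((int n + 1) * int K ^ n)
    = (int (Suc (Suc n)) + 1) * int K ^ Suc (Suc n)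
      + (int K ^ 2 + 4) * ((int n + 1) * int K ^ n)"
    by (simp add: algebra_simps power2_eq_square)
  also have "[\<dots> = (int (Suc (Suc n)) + 1) * int K ^ Suc (Suc n)] (mod (int K ^ 2 + 4))"
    by (simp add: cong_iff_dvd_diff)
  finally show ?case .
qed simp_all

text \<open>The double root K/2 has square -1 modulo q, hence its 4q-th power is 1, while the linear
  factor n + 1 is governed by n modulo q.\<close>

lemma kfib_is_period_ramified_prime:
  assumes "prime q" "odd q" "q dvd K ^ 2 + 4"
  shows "kfib_is_period K q (4 * q)"
proof -
  have d: "int q dvd int K ^ 2 + 4"
    using assms(3) by (metis int_dvd_int_iff of_nat_add of_nat_numeral of_nat_power)
  have K2: "[int K ^ 2 = - 4] (mod int q)"
    using d by (simp add: cong_iff_dvd_diff)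
  have co: "coprime (2 ^ k) (int q)" for k using assms(2) by simp
  \<comment> \<open>The discriminant congruence at n describes F(n+1), so F(4q) needs the index one
    lower.\<close>
  define n where "n = 4 * q - 1"
  have n: "4 * q = Suc n" using prime_gt_0_nat[OF assms(1)] by (simp add: n_def)
  have "[2 ^ n * int (kfib K (4 * q)) = (int n + 1) * int K ^ n] (mod int q)"
    unfolding n by (rule cong_dvd_modulus[OF kfib_cong_discriminant d])
  also have "int n + 1 = 4 * int q" using n by linarith
  also have "[4 * int q * int K ^ n = 2 ^ n * 0] (mod int q)"
    by (simp add: cong_0_iff)
  finally have 1: "[int (kfib K (4 * q)) = 0] (mod int q)"
    using cong_mult_lcancel[OF co] by blast
  have "[2 ^ (4 * q) * int (kfib K (Suc (4 * q))) = (int (4 * q) + 1) * int K ^ (4 * q)] (mod int q)"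
    by (rule cong_dvd_modulus[OF kfib_cong_discriminant d])
  also have "[(int (4 * q) + 1) * int K ^ (4 * q) = 1 * int K ^ (4 * q)] (mod int q)"
    by (intro cong_mult cong_refl) (simp add: cong_iff_dvd_diff)
  also have "1 * int K ^ (4 * q) = (int K ^ 2) ^ (2 * q)" by (simp flip: power_mult)
  also have "[(int K ^ 2) ^ (2 * q) = (- 4) ^ (2 * q)] (mod int q)"
    by (intro cong_pow K2)
  also have "(- 4 :: int) ^ (2 * q) = 2 ^ (4 * q) * 1"
    by (simp add: power_mult)
  finally have "[int (kfib K (Suc (4 * q))) = 1] (mod int q)"
    using cong_mult_lcancel[OF co] by blast
  with 1 show ?thesis by (rule kfib_is_periodI)
qed

text \<open>Determinants show that t is even. The discriminant congruence at F(t) then gives q | t,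
  and at F(t+1) it gives (K/2)^t = 1 modulo q. Since (K/2)^2 = -1, the half of t is even
  too.\<close>

lemma four_dvd_kfib_is_period:
  assumes "prime q" "odd q" "q dvd K ^ 2 + 4" "kfib_is_period K q t" "0 < t"
  shows "4 dvd t"
proof -
  have d: "int q dvd int K ^ 2 + 4"
    using assms(3) by (metis int_dvd_int_iff of_nat_add of_nat_numeral of_nat_power)
  have K2: "[int K ^ 2 = - 4] (mod int q)"
    using d by (simp add: cong_iff_dvd_diff)
  have co: "coprime (2 ^ k) (int q)" for k using assms(2) by simp
  have pq: "prime (int q)" using assms by simp
  have n2: "\<not> int q dvd 2"
    using assms(1,2)
    by (metis dvd_refl int_dvd_int_iff of_nat_numeral primes_dvd_imp_eq two_is_prime_nat)
  have sgn: "even k" if "[(-1) ^ k = (1::int)] (mod int q)" for k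
    using that n2 by (cases "even k") (auto simp: cong_iff_dvd_diff)
  obtain s where s: "t = Suc s" using assms(5) gr0_implies_Suc by blast
  have 0: "int q dvd int (kfib K t)" and 1: "int q dvd int (kfib K (Suc t)) - 1"
    using kfib_is_periodD[OF assms(4)] by (auto simp: cong_iff_dvd_diff)
  have "int (kfib K s) - 1 = (int (kfib K (Suc t)) - 1) - int K * int (kfib K t)"
    by (simp add: s)
  then have 2: "int q dvd int (kfib K s) - 1" using 0 1 by (metis dvd_diff dvd_mult)
  \<comment> \<open>Cassini's identity at s = t - 1, arranged so that every term on the right
    vanishes modulo q.\<close>
  have "(-1) ^ t - (1 :: int) = (int (kfib K (Suc t)) - 1) * int (kfib K s) + (int (kfib K s) - 1)
     - int (kfib K t) * int (kfib K t)"
    using kfib_cassini[of K s] s by (simp add: algebra_simps power2_eq_square)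
  then have "int q dvd (-1) ^ t - (1 :: int)" using 0 1 2 by (metis dvd_add dvd_diff dvd_mult2)
  then have "even t" by (intro sgn) (simp add: cong_iff_dvd_diff)
  \<comment> \<open>For q not dividing K, the power of K can be cancelled below, leaving q |
    t.\<close>
  then obtain u where u: "t = 2 * u" by blast
  have K0: "\<not> int q dvd int K"
  proof
    assume "int q dvd int K"
    then have "int q dvd int K ^ 2" by (simp add: power2_eq_square)
    then have "int q dvd 2 * 2" using d by (simp add: dvd_add_right_iff)
    then show False using n2 pq prime_dvd_mult_iff by blast
  qed
  have "[2 ^ s * int (kfib K t) = (int s + 1) * int K ^ s] (mod int q)"
    unfolding s by (rule cong_dvd_modulus[OF kfib_cong_discriminant d])
  then have "int q dvd (int s + 1) * int K ^ s"
    using 0 cong_dvd_iff dvd_mult by blast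
  then have qt: "int q dvd int t"
    using K0 pq s prime_dvd_power[OF pq, of "int K" s] by (simp only: prime_dvd_mult_iff)
      (metis add.commute of_nat_Suc)
  have "[2 ^ t * 1 = 2 ^ t * int (kfib K (Suc t))] (mod int q)"
    using 1 by (intro cong_mult cong_refl) (simp add: cong_iff_dvd_diff dvd_diff_commute)
  also have "[2 ^ t * int (kfib K (Suc t)) = (int t + 1) * int K ^ t] (mod int q)"
    by (rule cong_dvd_modulus[OF kfib_cong_discriminant d])
  also have "[(int t + 1) * int K ^ t = 1 * int K ^ t] (mod int q)"
    using qt by (intro cong_mult cong_refl) (simp add: cong_iff_dvd_diff)
  also have "1 * int K ^ t = (int K ^ 2) ^ u" by (simp add: u flip: power_mult)
  also have "[(int K ^ 2) ^ u = (- 4) ^ u] (mod int q)" by (intro cong_pow K2)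
  also have "(- 4 :: int) ^ u = 2 ^ t * (-1) ^ u"
    by (simp add: u power_mult flip: power_mult_distrib)
  finally have "[1 = (-1) ^ u] (mod int q)"
    using cong_mult_lcancel[OF co] by blast
  then have "even u" by (intro sgn) (rule cong_sym)
  then show ?thesis using u by auto
qed

section \<open>A period for an arbitrary modulus\<close>

text \<open>Some period modulo q, not necessarily the shortest. The prime 2 is tested first because
  it divides D when K is even.\<close>

definition prime_period :: "nat \<Rightarrow> nat \<Rightarrow> nat" where
  "prime_period K q =
     (if q = 2 then 2 else if q dvd K ^ 2 + 4 then 4 * q else 2 * (q - 1) * (q + 1))"

lemma kfib_is_period_prime_period:
  assumes "even K" "prime q"
  shows "kfib_is_period K q (prime_period K q)"
proof (cases "q = 2")
  case True
  \<comment> \<open>For even K, F(2) = K is even and F(3) = K^2 + 1 is odd.\<close>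
  have "kfib_is_period K 2 2"
    by (rule kfib_is_periodI) (use assms in \<open>simp_all add: numeral_2_eq_2 cong_iff_dvd_diff\<close>)
  with True show ?thesis by (simp add: prime_period_def)
next
  case False
  then have "odd q" using assms(2) primes_dvd_imp_eq two_is_prime_nat by blast
  with False assms show ?thesis
    using kfib_is_period_regular_prime kfib_is_period_ramified_prime
    by (simp add: prime_period_def)
qed

lemma prime_period_prod_pos:
  "0 < (\<Prod>q\<in>prime_factors m. q ^ (multiplicity q m - 1) * prime_period K q)"
proof (rule prod_pos)
  fix q assume "q \<in> prime_factors m"
  then have "1 < q" using in_prime_factors_imp_prime prime_gt_1_nat by blast
  then show "0 < q ^ (multiplicity q m - 1) * prime_period K q"
    by (simp add: prime_period_def)
qed

text \<open>The product is a multiple of a period modulo each prime power exactly dividing m, and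
  coprime moduli combine.\<close>

lemma kfib_is_period_composite:
  assumes "even K" "0 < m"
  shows "kfib_is_period K m
    (\<Prod>q\<in>prime_factors m. q ^ (multiplicity q m - 1) * prime_period K q)"
    (is "kfib_is_period K m ?T")
proof -
  have "[kfib K (n + ?T) = kfib K n] (mod (\<Prod>q\<in>prime_factors m. q ^ multiplicity q m))" for n
  proof (rule coprime_cong_prod_nat)
    fix q assume q: "q \<in> prime_factors m"
    then have pr: "prime q" and "0 < multiplicity q m" by (auto simp: prime_factors_multiplicity)
    then obtain e where e: "multiplicity q m = Suc e" using gr0_implies_Suc by blast
    have "kfib_is_period K (q ^ Suc e) (q ^ e * prime_period K q)"
      by (intro kfib_is_period_prime_power kfib_is_period_prime_period assms pr)
    moreover have "q ^ e * prime_period K q dvd ?T"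
      using dvd_prodI[OF _ q, of "\<lambda>q. q ^ (multiplicity q m - 1) * prime_period K q"] e by simp
    ultimately have "kfib_is_period K (q ^ Suc e) ?T" by (rule kfib_is_period_dvd)
    then show "[kfib K (n + ?T) = kfib K n] (mod q ^ multiplicity q m)"
      unfolding e kfib_is_period_def by blast
  next
    fix q q' assume "q \<in> prime_factors m" "q' \<in> prime_factors m" "q \<noteq> q'"
    then show "coprime (q ^ multiplicity q m) (q' ^ multiplicity q' m)"
      by (auto intro!: primes_coprime)
  qed
  moreover have "(\<Prod>q\<in>prime_factors m. q ^ multiplicity q m) = m"
    using assms(2) prime_factorization_nat by simp
  ultimately show ?thesis unfolding kfib_is_period_def by simp
qed

section \<open>Moduli equal to their own period\<close>

text \<open>The assumption \<open>le\<close> says that q bounds every regular r under consideration;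
  then r - 1 and r + 1 have no room for the factor q.\<close>

lemma regular_prime_not_dvd_prime_period:
  assumes "prime q" "odd q" "\<not> q dvd K ^ 2 + 4" "prime r"
    and le: "odd r \<Longrightarrow> \<not> r dvd K ^ 2 + 4 \<Longrightarrow> r \<le> q"
  shows "\<not> q dvd prime_period K r"
proof
  assume dv: "q dvd prime_period K r"
  have q2: "\<not> q dvd 2"
    using assms(1,2) primes_dvd_imp_eq two_is_prime_nat by blast
  then have q4: "\<not> q dvd 4"
    using assms(1) prime_dvd_mult_iff[of q 2 2] by simp
  consider "r = 2" | "odd r" "r dvd K ^ 2 + 4" | "odd r" "\<not> r dvd K ^ 2 + 4"
    using assms(4) primes_dvd_imp_eq two_is_prime_nat by blast
  then show False
  proof cases
    case 1
    then show False using dv q2 by (simp add: prime_period_def)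
  next
    case 2
    then have "r \<noteq> 2" by auto
    then have "q dvd 4 * r" using dv 2 by (simp add: prime_period_def)
    then have "q dvd r" using q4 assms(1) prime_dvd_mult_iff by blast
    then have "q = r" using assms(1,4) primes_dvd_imp_eq by blast
    then show False using 2 assms(3) by simp
  next
    case 3
    then have "r \<noteq> 2" by auto
    then have "q dvd 2 * (r - 1) * (r + 1)" using dv 3 by (simp add: prime_period_def)
    then have "q dvd r - 1 \<or> q dvd r + 1"
      using q2 assms(1) prime_dvd_mult_iff by blast
    moreover have "r \<le> q" using le 3 by blast
    moreover have "1 < r" using assms(4) prime_gt_1_nat by blast
    \<comment> \<open>Since r is at most q, a divisor q of r + 1 is r + 1 or r itself; parity
      excludes the first, coprimality of q and q + 1 the second.\<close>
    ultimately have "q \<le> r - 1 \<or> q = r + 1 \<or> (q = r \<and> q dvd r + 1)"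
      by (auto dest: dvd_imp_le)
    moreover have "q \<noteq> r + 1" using 3 assms(2) by auto
    moreover have "\<not> q dvd q + 1"
      using assms(1) by (metis dvd_add_right_iff dvd_refl not_prime_unit)
    ultimately show False using \<open>r \<le> q\<close> \<open>1 < r\<close> by auto
  qed
qed

lemma prime_dvd_discriminant_if_fixed:
  assumes "even K" "1 < m" "kfib_period K m = m" "prime q" "odd q" "q dvd m"
  shows "q dvd K ^ 2 + 4"
proof (rule ccontr)
  assume "\<not> q dvd K ^ 2 + 4"
  \<comment> \<open>The odd prime factors of m violating the claim; the largest one, Q, divides no
    local period.\<close>
  define B where "B = {q \<in> prime_factors m. odd q \<and> \<not> q dvd K ^ 2 + 4}"
  have "q \<in> B"
    using assms \<open>\<not> q dvd K ^ 2 + 4\<close> by (simp add: B_def in_prime_factors_iff)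
  moreover have "finite B" by (simp add: B_def)
  ultimately have "Max B \<in> B" and max: "\<And>r. r \<in> B \<Longrightarrow> r \<le> Max B"
    using Max_in[of B] Max_ge[of B] by blast+
  define Q where "Q = Max B"
  have Q: "Q \<in> prime_factors m" "prime Q" "odd Q" "\<not> Q dvd K ^ 2 + 4"
    using \<open>Max B \<in> B\<close> by (auto simp: B_def Q_def)
  let ?f = "\<lambda>q. q ^ (multiplicity q m - 1) * prime_period K q"
  have ndvd: "\<not> Q dvd prime_period K r" if "r \<in> prime_factors m" for r
    using that max by (intro regular_prime_not_dvd_prime_period Q) (auto simp: B_def Q_def)
  have "m dvd prod ?f (prime_factors m)"
    using kfib_period_dvd[OF kfib_is_period_composite[OF assms(1), of m] prime_period_prod_pos]
      assms(2,3) by simp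
  also have "prod ?f (prime_factors m) = ?f Q * prod ?f (prime_factors m - {Q})"
    by (rule prod.remove) (use Q in auto)
  finally have md: "m dvd ?f Q * prod ?f (prime_factors m - {Q})" .
  have "0 < multiplicity Q m" using Q(1) by (simp add: prime_factors_multiplicity)
  then obtain e where e: "multiplicity Q m = Suc e" using gr0_implies_Suc by blast
  have "Q ^ Suc e dvd m" using multiplicity_dvd[of Q m] e by simp
  with md have "Q ^ Suc e dvd ?f Q * prod ?f (prime_factors m - {Q})" by (rule dvd_trans[rotated])
  \<comment> \<open>m contributes Q^(e+1), but the explicit power in the product is only Q^e; after
    cancellation one factor Q has no place to go.\<close>
  then have "Q ^ e * Q dvd Q ^ e * (prime_period K Q * prod ?f (prime_factors m - {Q}))"
    by (simp only: e diff_Suc_1 power_Suc2 mult.assoc)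
  then have "Q dvd prime_period K Q * prod ?f (prime_factors m - {Q})"
    using prime_gt_0_nat[OF Q(2)] by (simp only: nat_mult_dvd_cancel1 zero_less_power)
  then have "Q dvd prod ?f (prime_factors m - {Q})"
    using ndvd[OF Q(1)] Q(2) prime_dvd_mult_iff by blast
  then obtain r where r: "r \<in> prime_factors m" "r \<noteq> Q" "Q dvd ?f r"
    using Q(2) by (auto simp: prime_dvd_prod_iff)
  then have "Q dvd r ^ (multiplicity r m - 1)"
    using ndvd[OF r(1)] Q(2) prime_dvd_mult_iff by blast
  then have "Q dvd r" using Q(2) prime_dvd_power by blast
  then show False using r Q(2) primes_dvd_imp_eq by blast
qed

text \<open>Being a period modulo m, the number m is also a period modulo its factor q, which
  divides D.\<close>

lemma four_dvd_if_fixed: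
  assumes "even K" "1 < m" "kfib_period K m = m" "prime q" "odd q" "q dvd m"
  shows "4 dvd m"
proof -
  have "kfib_is_period K m m"
    using kfib_period_is_period(1)[OF kfib_is_period_composite[OF assms(1), of m]
      prime_period_prod_pos] assms(2,3) by simp
  then have "kfib_is_period K q m" using assms(6) by (rule kfib_is_period_modulus_dvd)
  then show ?thesis
    using four_dvd_kfib_is_period[OF assms(4,5) prime_dvd_discriminant_if_fixed[OF assms]] assms(2)
    by simp
qed

theorem theorem3p4:
  fixes K r m :: nat and p a :: "nat \<Rightarrow> nat"
  assumes "K \<ge> 1" and "[K = 2] (mod 4)"
    and "r \<ge> 1"
    and "\<And>i. i \<in> {1..r} \<Longrightarrow> prime (p i)"
    and "inj_on p {1..r}"
    and "\<And>i. i \<in> {1..r} \<Longrightarrow> a i \<ge> 1"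
    and "K ^ 2 + 4 = (\<Prod>i = 1..r. p i ^ a i)"
    and "p 1 = 2"
    and "m > 1" and "kfib_period K m = m"
  shows "\<exists>j :: nat \<Rightarrow> nat.
           m = 2 ^ (j 1 + 1) \<or> m = 2 ^ (j 1 + 2) * (\<Prod>i = 2..r. p i ^ j i)"
proof -
  have "even K"
    using assms(2) cong_dvd_modulus_nat[of K 2 4 2] by (simp add: cong_def even_iff_mod_2_eq_zero)
  note fixed = this assms(9,10)
  have sub: "prime_factors m \<subseteq> p ` {1..r}"
  proof
    fix q assume "q \<in> prime_factors m"
    then have q: "prime q" "q dvd m" by auto
    show "q \<in> p ` {1..r}"
    proof (cases "even q")
      case True
      then have "q = p 1" using q(1) assms(8) primes_dvd_imp_eq two_is_prime_nat by metis
      then show ?thesis using assms(3) by simp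
    next
      case False
      then have "q dvd (\<Prod>i = 1..r. p i ^ a i)"
        using prime_dvd_discriminant_if_fixed[OF fixed q(1) False q(2)] assms(7) by simp
      then obtain i where i: "i \<in> {1..r}" "q dvd p i ^ a i"
        using q(1) by (auto simp: prime_dvd_prod_iff)
      then have "q dvd p i" using q(1) prime_dvd_power by blast
      then have "q = p i" using q(1) assms(4)[OF i(1)] primes_dvd_imp_eq by blast
      then show ?thesis using i(1) by blast
    qed
  qed
  define e where "e i = multiplicity (p i) m" for i
  have "m = (\<Prod>q\<in>prime_factors m. q ^ multiplicity q m)"
    using assms(9) prime_factorization_nat by simp
  \<comment> \<open>The added primes do not divide m and carry exponent 0.\<close>
  also have "\<dots> = (\<Prod>q\<in>p ` {1..r}. q ^ multiplicity q m)"
    using sub assms(4)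
    by (intro prod.mono_neutral_left) (auto simp: prime_factors_multiplicity)
  also have "\<dots> = (\<Prod>i = 1..r. p i ^ e i)"
    using assms(5) by (simp add: prod.reindex e_def)
  also have "\<dots> = 2 ^ e 1 * (\<Prod>i = 2..r. p i ^ e i)"
    using assms(3,8) by (simp add: prod.atLeast_Suc_atMost numeral_2_eq_2)
  finally have m: "m = 2 ^ e 1 * (\<Prod>i = 2..r. p i ^ e i)" .
  show ?thesis
  proof (cases "\<exists>i\<in>{2..r}. e i \<noteq> 0")
    case True
    then obtain i where i: "i \<in> {2..r}" "e i \<noteq> 0" by blast
    have pr: "prime (p i)" using i assms(4) by simp
    have "p i \<noteq> p 1" using inj_onD[OF assms(5), of i 1] i assms(3) by auto
    then have "odd (p i)" using pr assms(8) primes_dvd_imp_eq two_is_prime_nat by metis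
    moreover have "p i dvd m" using i(2) unfolding e_def by (metis not_dvd_imp_multiplicity_0)
    ultimately have "4 dvd m" using four_dvd_if_fixed[OF fixed pr] by blast
    then have "2 ^ 2 dvd m" by simp
    then have "2 \<le> e 1"
      unfolding e_def assms(8) by (intro multiplicity_geI) (use assms(9) in simp_all)
    \<comment> \<open>The witness lowers the exponent of 2 by two; the product over i from 2 on does
      not see index 1.\<close>
    then have "e 1 = (e(1 := e 1 - 2)) 1 + 2" by simp
    moreover have "(\<Prod>i = 2..r. p i ^ e i) = (\<Prod>i = 2..r. p i ^ (e(1 := e 1 - 2)) i)" by simp
    ultimately have "m = 2 ^ ((e(1 := e 1 - 2)) 1 + 2) * (\<Prod>i = 2..r. p i ^ (e(1 := e 1 - 2)) i)"
      using m by metis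
    then show ?thesis by blast
  next
    case False
    then have "m = 2 ^ e 1" using m by simp
    \<comment> \<open>The bound m > 1 excludes exponent 0, so subtracting 1 for the witness is
      exact.\<close>
    moreover from this have "e 1 \<noteq> 0" using assms(9) by (metis less_irrefl power_0)
    ultimately have "m = 2 ^ ((\<lambda>_. e 1 - 1) (1::nat) + 1)" by simp
    then show ?thesis by blast
  qed
qed

end
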